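(* Let $n\ge 1$ and let $s>n-1$ be real. If $Z\subset Q^n_1$ has positive $s$-Hausdorff measure, then $Z$ is $d$-definite for every integer $d\ge1$.
   Context: $Q^n_1=[0,1]^n\subset\mathbb{R}^n$ is the unit cube. A set $Z\subset Q^n_1$ is called $d$-definite if there is a constant $C(d,Z)$ such that every real polynomial $P(x_1,\dots,x_n)$ of degree at most $d$ with $|P|\le 1$ on $Z$ satisfies $|P|\le C(d,Z)$ on $Q^n_1$. For $\beta>0$ the $\beta$-Hausdorff measure is $H_\beta(Z)=\lim_{\alpha\to0}H^\alpha_\beta(Z)$, where $H^\alpha_\beta(Z)$ is the infimum of the sums $\sum_{i=1}^\infty r_i^\beta$ over all countable covers $Z\subset\bigcup_{i}A_i$ with (Euclidean) $\mathrm{diam}\,A_i\le r_i\le\alpha$. *)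

theory Defs
  imports "HOL-Analysis.Analysis" "HOL-Library.Poly_Mapping"
begin

section \<open>Real polynomials in finitely many variables\<close>

text \<open>
  The variables are indexed by a finite type \<open>'n\<close>, so \<open>n\<close> is \<open>CARD('n)\<close>. A monomial is a
  finitely supported exponent vector; a polynomial is a finitely supported family of
  coefficients. The ring structure is the one of \<open>Poly_Mapping\<close>.
\<close>

type_synonym 'n real_mpoly = "('n \<Rightarrow>\<^sub>0 nat) \<Rightarrow>\<^sub>0 real"

definition mpoly_eval :: "'n::finite real_mpoly \<Rightarrow> real ^ 'n \<Rightarrow> real" where
  "mpoly_eval P x =
     (\<Sum>m\<in>Poly_Mapping.keys P. Poly_Mapping.lookup P m * (\<Prod>i\<in>UNIV. (x $ i) ^ Poly_Mapping.lookup m i))"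

text \<open>Total degree, with the convention that the zero polynomial has degree \<open>0\<close>.\<close>

definition mpoly_degree :: "'n::finite real_mpoly \<Rightarrow> nat" where
  "mpoly_degree P =
     Max (insert 0 ((\<lambda>m. \<Sum>i\<in>UNIV. Poly_Mapping.lookup m i) ` Poly_Mapping.keys P))"

lemma mpoly_degree_le_iff:
  "mpoly_degree P \<le> d \<longleftrightarrow>
     (\<forall>m\<in>Poly_Mapping.keys P. (\<Sum>i\<in>UNIV. Poly_Mapping.lookup m i) \<le> d)"
  by (simp add: mpoly_degree_def)


section \<open>Definite subsets of the unit cube\<close>

definition unit_cube :: "(real ^ 'n::finite) set" where
  "unit_cube = {x. \<forall>i. 0 \<le> x $ i \<and> x $ i \<le> 1}"

definition definite :: "nat \<Rightarrow> (real ^ 'n::finite) set \<Rightarrow> bool" where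
  "definite d Z \<longleftrightarrow> Z \<subseteq> unit_cube \<and>
     (\<exists>C::real. \<forall>P. mpoly_degree P \<le> d \<longrightarrow> (\<forall>x\<in>Z. \<bar>mpoly_eval P x\<bar> \<le> 1) \<longrightarrow>
        (\<forall>x\<in>unit_cube. \<bar>mpoly_eval P x\<bar> \<le> C))"


section \<open>Hausdorff measure\<close>

text \<open>
  Boundedness of the covering sets is stated separately because \<^const>\<open>diameter\<close> is not
  meaningful for unbounded sets. The condition \<open>diameter (A i) \<le> r i\<close> forces \<open>0 \<le> r i\<close>.
  The infimum over no covers at all is \<open>\<infinity>\<close>. The definitions are meant for \<open>\<beta> > 0\<close>,
  where \<open>0 powr \<beta> = 0\<close> is the usual value.
\<close>

definition hausdorff_premeasure :: "real \<Rightarrow> real \<Rightarrow> 'a::metric_space set \<Rightarrow> ennreal" where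
  "hausdorff_premeasure \<alpha> \<beta> Z =
     Inf {suminf (\<lambda>i. ennreal (r i powr \<beta>)) | (A :: nat \<Rightarrow> 'a set) (r :: nat \<Rightarrow> real).
            Z \<subseteq> (\<Union>i. A i) \<and> (\<forall>i. bounded (A i) \<and> diameter (A i) \<le> r i \<and> r i \<le> \<alpha>)}"

definition hausdorff_measure :: "real \<Rightarrow> 'a::metric_space set \<Rightarrow> ennreal" where
  "hausdorff_measure \<beta> Z = Lim (at_right 0) (\<lambda>\<alpha>. hausdorff_premeasure \<alpha> \<beta> Z)"

text \<open>The limit exists for every set.\<close>

lemma hausdorff_premeasure_antimono:
  "\<alpha> \<le> \<alpha>' \<Longrightarrow> hausdorff_premeasure \<alpha>' \<beta> Z \<le> hausdorff_premeasure \<alpha> \<beta> Z"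
  unfolding hausdorff_premeasure_def by (rule Inf_superset_mono) (blast intro: order_trans)

lemma hausdorff_premeasure_tendsto_SUP:
  "((\<lambda>\<alpha>. hausdorff_premeasure \<alpha> \<beta> Z) \<longlongrightarrow> (SUP \<alpha>\<in>{0<..}. hausdorff_premeasure \<alpha> \<beta> Z)) (at_right 0)"
  (is "(?f \<longlongrightarrow> ?S) _")
proof (rule order_tendstoI)
  fix a assume "a < ?S"
  then obtain \<alpha> where \<alpha>: "\<alpha> > 0" "a < ?f \<alpha>"
    by (auto simp: less_SUP_iff)
  show "eventually (\<lambda>x. a < ?f x) (at_right 0)"
    unfolding eventually_at_right_field
    using \<alpha> hausdorff_premeasure_antimono[of _ \<alpha> \<beta> Z] by (meson less_imp_le less_le_trans)
next
  fix a assume "?S < a"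
  moreover have "?f x \<le> ?S" if "x > 0" for x
    using that by (intro SUP_upper) auto
  ultimately show "eventually (\<lambda>x. ?f x < a) (at_right 0)"
    unfolding eventually_at_right_field by (meson le_less_trans gt_ex)
qed

lemma hausdorff_premeasure_tendsto:
  "((\<lambda>\<alpha>. hausdorff_premeasure \<alpha> \<beta> Z) \<longlongrightarrow> hausdorff_measure \<beta> Z) (at_right 0)"
  using hausdorff_premeasure_tendsto_SUP[of \<beta> Z]
  by (simp add: hausdorff_measure_def tendsto_Lim)

lemma hausdorff_measure_eq_SUP:
  "hausdorff_measure \<beta> Z = (SUP \<alpha>\<in>{0<..}. hausdorff_premeasure \<alpha> \<beta> Z)"
  using hausdorff_premeasure_tendsto_SUP[of \<beta> Z]
  by (simp add: hausdorff_measure_def tendsto_Lim)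

end

theory Submission
  imports Defs
begin

text \<open>
  A set \<open>Z\<close> fails to control polynomials of degree at most \<open>d\<close> only if some nonzero polynomial
  of that degree vanishes on it, and zero sets of nonzero polynomials are too thin to carry
  positive \<open>s\<close>-dimensional measure when \<open>s > n - 1\<close>. Both halves have short direct proofs.

  Thinness (\<open>hausdorff_null_poly_fun_zeros\<close>) goes by induction on the degree. A nonconstant
  polynomial \<open>f\<close> has a partial derivative \<open>g\<close> that is a nonzero polynomial of smaller degree.
  The zeros of \<open>f\<close> where \<open>g\<close> vanishes lie in the zero set of \<open>g\<close>, which is null by induction.
  Near a zero of \<open>f\<close> where \<open>g\<close>, the derivative along coordinate \<open>i\<close>, does not vanish, the mean
  value theorem shows that on the zero set coordinate \<open>i\<close> is a Lipschitz function of the others.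
  This is all that is used of the implicit function theorem: cutting the other
  \<open>n - 1\<close> coordinates into intervals of length \<open>1 / m\<close> covers such a piece by \<open>O(m ^ (n - 1))\<close>
  sets of diameter \<open>O(1 / m)\<close>, and \<open>m ^ (n - 1) * m powr (- s)\<close> tends to \<open>0\<close>. Countably many
  pieces suffice by the Lindelof property.

  Control (\<open>definite_if_determining\<close>): if only the zero polynomial of degree at most \<open>d\<close> vanishes
  on \<open>Z\<close>, then finitely many points of \<open>Z\<close> carry a Lagrange basis of the polynomials of degree at
  most \<open>d\<close>. The values at these points recover the polynomial, with coefficients that are
  bounded on the cube.
\<close>

section \<open>Null sets of the Hausdorff measure\<close>

lemma hausdorff_premeasure_leI:
  assumes "Z \<subseteq> (\<Union>i. A i)" and "\<And>i. bounded (A i)" and "\<And>i. diameter (A i) \<le> r i" and "\<And>i. r i \<le> \<alpha>"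
  shows "hausdorff_premeasure \<alpha> \<beta> Z \<le> suminf (\<lambda>i. ennreal (r i powr \<beta>))"
  unfolding hausdorff_premeasure_def using assms by (intro Inf_lower) blast

lemma hausdorff_premeasure_lessE:
  assumes "hausdorff_premeasure \<alpha> \<beta> Z < e"
  obtains A r where "Z \<subseteq> (\<Union>i::nat. A i)" "\<And>i. bounded (A i)" "\<And>i. diameter (A i) \<le> r i"
    "\<And>i. r i \<le> \<alpha>" "suminf (\<lambda>i. ennreal (r i powr \<beta>)) < e"
  using assms unfolding hausdorff_premeasure_def Inf_less_iff by blast

lemma hausdorff_measure_eq_0_iff:
  "hausdorff_measure \<beta> Z = 0 \<longleftrightarrow> (\<forall>\<alpha>>0. hausdorff_premeasure \<alpha> \<beta> Z = 0)"
proof -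
  have "hausdorff_measure \<beta> Z \<le> 0 \<longleftrightarrow> (\<forall>\<alpha>>0. hausdorff_premeasure \<alpha> \<beta> Z \<le> 0)"
    unfolding hausdorff_measure_eq_SUP SUP_le_iff by auto
  then show ?thesis by simp
qed

lemma hausdorff_null_subset:
  assumes "hausdorff_measure \<beta> Y = 0" and "Z \<subseteq> Y"
  shows "hausdorff_measure \<beta> Z = 0"
proof -
  have "hausdorff_premeasure \<alpha> \<beta> Z \<le> hausdorff_premeasure \<alpha> \<beta> Y" for \<alpha>
    unfolding hausdorff_premeasure_def using assms(2) by (intro Inf_superset_mono) blast
  with assms(1) show ?thesis
    unfolding hausdorff_measure_eq_0_iff by (metis le_zero_eq)
qed

text \<open>
  The usual \<open>e / 2 ^ (k + 1)\<close> argument: near-optimal covers of the sets \<open>Z k\<close> are merged into one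
  sequence by enumerating pairs of indices.
\<close>

lemma hausdorff_null_UN_nat:
  fixes Z :: "nat \<Rightarrow> 'a::metric_space set"
  assumes null: "\<And>k. hausdorff_measure \<beta> (Z k) = 0"
  shows "hausdorff_measure \<beta> (\<Union>k. Z k) = 0"
  unfolding hausdorff_measure_eq_0_iff
proof (intro allI impI)
  fix \<alpha> :: real assume "\<alpha> > 0"
  have "hausdorff_premeasure \<alpha> \<beta> (\<Union>k. Z k) \<le> 0 + ennreal e" if "e > 0" for e :: real
  proof -
    have "\<exists>A r. Z k \<subseteq> (\<Union>i::nat. A i) \<and> (\<forall>i. bounded (A i)) \<and> (\<forall>i. diameter (A i) \<le> r i) \<and>
        (\<forall>i. r i \<le> \<alpha>) \<and> suminf (\<lambda>i. ennreal (r i powr \<beta>)) < ennreal (e * (1/2) ^ Suc k)" for k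
    proof -
      have "hausdorff_premeasure \<alpha> \<beta> (Z k) < ennreal (e * (1/2) ^ Suc k)"
        using null[of k] \<open>\<alpha> > 0\<close> \<open>e > 0\<close> by (simp add: hausdorff_measure_eq_0_iff)
      then show ?thesis by (rule hausdorff_premeasure_lessE) blast
    qed
    then obtain A r where cover: "\<And>k. Z k \<subseteq> (\<Union>i::nat. A k i)"
      and bdd: "\<And>k i. bounded (A k i)" and diam: "\<And>k i. diameter (A k i) \<le> r k i"
      and small: "\<And>k i. r k i \<le> \<alpha>"
      and sum: "\<And>k. suminf (\<lambda>i. ennreal (r k i powr \<beta>)) < ennreal (e * (1/2) ^ Suc k)"
      by metis
    define p where "p j = prod_decode j" for j
    have "(\<Union>k. Z k) \<subseteq> (\<Union>j. A (fst (p j)) (snd (p j)))"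
    proof
      fix x assume "x \<in> (\<Union>k. Z k)"
      then obtain k i where "x \<in> A k i" using cover by blast
      then have "x \<in> A (fst (p (prod_encode (k, i)))) (snd (p (prod_encode (k, i))))"
        by (simp add: p_def)
      then show "x \<in> (\<Union>j. A (fst (p j)) (snd (p j)))" by (rule UN_I[OF UNIV_I])
    qed
    then have "hausdorff_premeasure \<alpha> \<beta> (\<Union>k. Z k)
        \<le> suminf (\<lambda>j. ennreal (r (fst (p j)) (snd (p j)) powr \<beta>))"
      by (rule hausdorff_premeasure_leI) (rule bdd diam small)+
    also have "\<dots> = suminf (\<lambda>k. suminf (\<lambda>i. ennreal (r k i powr \<beta>)))"
      unfolding p_def
      by (rule suminf_ennreal_2dimen[where f = "\<lambda>q. ennreal (r (fst q) (snd q) powr \<beta>)"]) simp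
    also have "\<dots> \<le> suminf (\<lambda>k. ennreal (e * (1/2) ^ Suc k))"
      by (intro suminf_le less_imp_le[OF sum]) auto
    also have "\<dots> = ennreal e"
      using \<open>e > 0\<close> sums_mult[OF power_half_series, of e]
      by (intro suminf_ennreal_eq) auto
    finally show ?thesis by simp
  qed
  then have "hausdorff_premeasure \<alpha> \<beta> (\<Union>k. Z k) \<le> 0"
    by (rule ennreal_le_epsilon)
  then show "hausdorff_premeasure \<alpha> \<beta> (\<Union>k. Z k) = 0" by simp
qed

lemma hausdorff_measure_empty [simp]: "hausdorff_measure \<beta> {} = 0"
proof -
  have "hausdorff_premeasure \<alpha> \<beta> {} \<le> suminf (\<lambda>i. ennreal (0 powr \<beta>))" if "\<alpha> > 0" for \<alpha>
    using that by (intro hausdorff_premeasure_leI[where A = "\<lambda>_. {}"]) auto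
  then show ?thesis by (auto simp: hausdorff_measure_eq_0_iff)
qed

lemma hausdorff_null_Union:
  assumes "countable F" and "\<And>S. S \<in> F \<Longrightarrow> hausdorff_measure \<beta> S = 0"
  shows "hausdorff_measure \<beta> (\<Union>F) = 0"
proof (cases "F = {}")
  case False
  then have "hausdorff_measure \<beta> (\<Union>k. from_nat_into F k) = 0"
    by (intro hausdorff_null_UN_nat assms from_nat_into)
  then show ?thesis
    by (simp add: range_from_nat_into[OF False assms(1)])
qed simp

lemma hausdorff_null_Un:
  assumes "hausdorff_measure \<beta> S = 0" and "hausdorff_measure \<beta> T = 0"
  shows "hausdorff_measure \<beta> (S \<union> T) = 0"
proof -
  have "hausdorff_measure \<beta> (\<Union>{S, T}) = 0"
    by (rule hausdorff_null_Union) (use assms in auto)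
  then show ?thesis by simp
qed

text \<open>
  Finite covers may be used in place of sequences: the sequence is padded with empty sets of
  diameter \<open>0\<close>, which cost nothing because \<open>0 powr \<beta> = 0\<close>.
\<close>

lemma hausdorff_premeasure_le_card:
  fixes A :: "'i \<Rightarrow> 'a::metric_space set"
  assumes "finite I" and cover: "Z \<subseteq> (\<Union>i\<in>I. A i)"
    and A: "\<And>i. i \<in> I \<Longrightarrow> bounded (A i) \<and> diameter (A i) \<le> r" and r: "0 \<le> r" "r \<le> \<alpha>"
  shows "hausdorff_premeasure \<alpha> \<beta> Z \<le> ennreal (card I * r powr \<beta>)"
proof -
  obtain h where h: "bij_betw h {0..<card I} I"
    using ex_bij_betw_nat_finite[OF \<open>finite I\<close>] by blast
  define A' where "A' k = (if k < card I then A (h k) else {})" for k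
  define r' where "r' k = (if k < card I then r else 0)" for k
  have hI: "h k \<in> I" if "k < card I" for k
    using bij_betwE[OF h] that by simp
  have "Z \<subseteq> (\<Union>k. A' k)"
  proof
    fix x assume "x \<in> Z"
    then obtain i where "i \<in> I" "x \<in> A i" using cover by blast
    then obtain k where "k < card I" "h k = i"
      using h unfolding bij_betw_def by (metis atLeastLessThan_iff imageE)
    with \<open>x \<in> A i\<close> have "x \<in> A' k" by (simp add: A'_def)
    then show "x \<in> (\<Union>k. A' k)" by blast
  qed
  then have "hausdorff_premeasure \<alpha> \<beta> Z \<le> suminf (\<lambda>k. ennreal (r' k powr \<beta>))"
    by (rule hausdorff_premeasure_leI) (use A hI r in \<open>auto simp: A'_def r'_def\<close>)
  also have "\<dots> = (\<Sum>k<card I. ennreal (r' k powr \<beta>))"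
    by (intro suminf_finite) (auto simp: r'_def)
  also have "\<dots> = (\<Sum>k<card I. ennreal (r powr \<beta>))"
    by (intro sum.cong) (auto simp: r'_def)
  also have "\<dots> = ennreal (card I * r powr \<beta>)"
    by (simp add: ennreal_mult ennreal_of_nat_eq_real_of_nat)
  finally show ?thesis .
qed

section \<open>Lipschitz graphs\<close>

lemma norm_le_by_other_coordinates:
  fixes v :: "real ^ 'n::finite"
  assumes "K \<ge> 0" and "\<bar>v $ i\<bar> \<le> K * (\<Sum>j\<in>-{i}. \<bar>v $ j\<bar>)"
    and "\<And>j. j \<noteq> i \<Longrightarrow> \<bar>v $ j\<bar> \<le> \<delta>" and "\<delta> \<ge> 0"
  shows "norm v \<le> (1 + K) * CARD('n) * \<delta>"
proof -
  have "(\<Sum>j\<in>-{i}. \<bar>v $ j\<bar>) \<le> real (card (-{i})) * \<delta>"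
    using assms(3) by (intro sum_bounded_above) auto
  also have "\<dots> \<le> CARD('n) * \<delta>"
    using assms(4) by (intro mult_right_mono) (auto intro!: card_mono)
  finally have others: "(\<Sum>j\<in>-{i}. \<bar>v $ j\<bar>) \<le> CARD('n) * \<delta>" .
  have "norm v \<le> (\<Sum>j\<in>UNIV. \<bar>v $ j\<bar>)" by (rule norm_le_l1_cart)
  also have "\<dots> = \<bar>v $ i\<bar> + (\<Sum>j\<in>-{i}. \<bar>v $ j\<bar>)"
    by (simp add: sum.remove[of UNIV i] Compl_eq_Diff_UNIV)
  also have "\<dots> \<le> (1 + K) * (\<Sum>j\<in>-{i}. \<bar>v $ j\<bar>)"
    using assms(2) by (simp add: distrib_right)
  also have "\<dots> \<le> (1 + K) * (CARD('n) * \<delta>)"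
    using others assms(1) by (intro mult_left_mono) auto
  finally show ?thesis by (simp add: mult.assoc)
qed

text \<open>
  The hypothesis says that \<open>S\<close> is a graph over the coordinates other than \<open>i\<close>, so a grid in those
  \<open>n - 1\<close> coordinates already cuts \<open>S\<close> into small pieces. The integer vectors
  \<open>\<lfloor>m * x $ j\<rfloor>\<close>, \<open>j \<noteq> i\<close>, label the pieces; each entry takes at most \<open>2 * m * R + 1\<close> values.
\<close>

lemma lipschitz_graph_premeasure_le:
  fixes S :: "(real ^ 'n::finite) set" and m R :: nat and K :: real
  assumes R: "\<And>x j. x \<in> S \<Longrightarrow> \<bar>x $ j\<bar> \<le> R" and K: "K \<ge> 0"
    and lip: "\<And>x y. x \<in> S \<Longrightarrow> y \<in> S \<Longrightarrow> \<bar>x $ i - y $ i\<bar> \<le> K * (\<Sum>j\<in>-{i}. \<bar>x $ j - y $ j\<bar>)"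
    and m: "m > 0" "(1 + K) * CARD('n) / m \<le> \<alpha>"
  shows "hausdorff_premeasure \<alpha> s S
    \<le> ennreal ((2 * m * R + 1) ^ (CARD('n) - 1) * ((1 + K) * CARD('n) / m) powr s)"
proof -
  define J where "J = -{i}"
  define G where "G = J \<rightarrow>\<^sub>E {-(int m * int R)..int m * int R}"
  define cell where "cell p = {x\<in>S. \<forall>j\<in>J. \<lfloor>m * x $ j\<rfloor> = p j}" for p
  define r where "r = (1 + K) * CARD('n) / m"
  have r: "r \<ge> 0" "r \<le> \<alpha>" using K m by (auto simp: r_def)
  have "finite G" unfolding G_def by (intro finite_PiE) auto
  have "card G = (2 * m * R + 1) ^ (CARD('n) - 1)"
  proof -
    have "nat (int m * int R - - (int m * int R) + 1) = 2 * m * R + 1"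
      by (simp flip: of_nat_mult)
    moreover have "card J = CARD('n) - 1"
      by (simp add: J_def Compl_eq_Diff_UNIV)
    ultimately show ?thesis
      unfolding G_def by (subst card_PiE) simp_all
  qed
  moreover have "S \<subseteq> (\<Union>p\<in>G. cell p)"
  proof
    fix x assume x: "x \<in> S"
    define p where "p = restrict (\<lambda>j. \<lfloor>m * x $ j\<rfloor>) J"
    have "p \<in> G" unfolding G_def p_def
    proof (rule restrict_PiE_iff[THEN iffD2], safe)
      fix j
      have "\<bar>m * x $ j\<bar> \<le> m * R"
        using R[OF x, of j] by (simp add: abs_mult mult_left_mono)
      then have "- (real m * R) \<le> m * x $ j" "m * x $ j \<le> real m * R" by auto
      then show "\<lfloor>m * x $ j\<rfloor> \<in> {-(int m * int R)..int m * int R}"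
        by (auto simp: le_floor_iff floor_le_iff)
    qed
    moreover have "x \<in> cell p" using x by (simp add: cell_def p_def)
    ultimately show "x \<in> (\<Union>p\<in>G. cell p)" by blast
  qed
  moreover have "bounded (cell p) \<and> diameter (cell p) \<le> r" for p
  proof -
    have "dist x y \<le> r" if "x \<in> cell p" "y \<in> cell p" for x y
    proof -
      have "norm (x - y) \<le> (1 + K) * CARD('n) * (1 / m)"
      proof (rule norm_le_by_other_coordinates[where i = i])
        show "\<bar>(x - y) $ i\<bar> \<le> K * (\<Sum>j\<in>-{i}. \<bar>(x - y) $ j\<bar>)"
          using lip that by (simp add: cell_def)
        show "\<bar>(x - y) $ j\<bar> \<le> 1 / m" if "j \<noteq> i" for j
        proof -
          have "\<lfloor>m * x $ j\<rfloor> = \<lfloor>m * y $ j\<rfloor>"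
            using \<open>x \<in> cell p\<close> \<open>y \<in> cell p\<close> \<open>j \<noteq> i\<close> by (simp add: cell_def J_def)
          then have "\<bar>m * x $ j - m * y $ j\<bar> \<le> 1" by linarith
          then have "m * \<bar>x $ j - y $ j\<bar> \<le> 1"
            by (simp add: abs_mult flip: right_diff_distrib)
          then show ?thesis using m by (simp add: field_simps)
        qed
      qed (use K in auto)
      then show ?thesis by (simp add: dist_norm r_def)
    qed
    then show ?thesis
      using r by (auto simp: bounded_two_points dist_norm intro!: diameter_le)
  qed
  ultimately show ?thesis
    using hausdorff_premeasure_le_card[of G S cell r \<alpha> s] \<open>finite G\<close> r by (simp add: r_def)
qed

lemma grid_bound_tendsto_0:
  fixes k :: nat and s c :: real
  assumes "s > k" and "c > 0"
  shows "(\<lambda>m. real ((2 * m * R + 1) ^ k) * (c / real m) powr s) \<longlonglongrightarrow> 0"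
proof (rule Lim_null_comparison)
  show "eventually (\<lambda>m. norm (real ((2 * m * R + 1) ^ k) * (c / real m) powr s)
      \<le> (2 * R + 1) ^ k * c powr s * real m powr (k - s)) sequentially"
  proof (rule eventually_sequentiallyI[of 1])
    fix m :: nat assume m: "1 \<le> m"
    have "2 * m * R + 1 \<le> (2 * R + 1) * m" using m by (simp add: algebra_simps)
    then have "real ((2 * m * R + 1) ^ k) \<le> real (((2 * R + 1) * m) ^ k)"
      by (intro of_nat_mono power_mono) auto
    also have "\<dots> = real ((2 * R + 1) ^ k) * real m powr k"
      using m unfolding power_mult_distrib by (simp add: powr_realpow)
    finally have "real ((2 * m * R + 1) ^ k) * (c / real m) powr s
        \<le> real ((2 * R + 1) ^ k) * real m powr k * (c / real m) powr s"
      by (intro mult_right_mono) auto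
    also have "\<dots> = real ((2 * R + 1) ^ k) * c powr s * real m powr (k - s)"
      using m assms by (simp add: powr_divide powr_diff)
    finally show "norm (real ((2 * m * R + 1) ^ k) * (c / real m) powr s)
      \<le> (2 * R + 1) ^ k * c powr s * real m powr (k - s)"
      by (simp add: abs_mult)
  qed
  have "(\<lambda>m. real m powr (k - s)) \<longlonglongrightarrow> 0"
    using assms by (intro tendsto_neg_powr filterlim_real_sequentially) simp
  then show "(\<lambda>m. (2 * R + 1) ^ k * c powr s * real m powr (k - s)) \<longlonglongrightarrow> 0"
    by (rule tendsto_mult_right_zero)
qed

lemma hausdorff_null_lipschitz_graph:
  fixes S :: "(real ^ 'n::finite) set"
  assumes s: "s > real CARD('n) - 1" and bdd: "bounded S" and K: "K \<ge> 0"
    and lip: "\<And>x y. x \<in> S \<Longrightarrow> y \<in> S \<Longrightarrow> \<bar>x $ i - y $ i\<bar> \<le> K * (\<Sum>j\<in>-{i}. \<bar>x $ j - y $ j\<bar>)"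
  shows "hausdorff_measure s S = 0"
  unfolding hausdorff_measure_eq_0_iff
proof (intro allI impI)
  fix \<alpha> :: real assume "\<alpha> > 0"
  define c where "c = (1 + K) * CARD('n)"
  have "c > 0" using K by (simp add: c_def)
  obtain B where "\<And>x. x \<in> S \<Longrightarrow> norm x \<le> B" using bdd by (auto simp: bounded_iff)
  moreover obtain R :: nat where "B \<le> R" using real_arch_simple by blast
  ultimately have R: "\<bar>x $ j\<bar> \<le> R" if "x \<in> S" for x j
    using that component_le_norm_cart[of x j] by fastforce
  define b where "b m = real ((2 * m * R + 1) ^ (CARD('n) - 1)) * (c / real m) powr s" for m
  have "b \<longlonglongrightarrow> 0"
    unfolding b_def using s \<open>c > 0\<close> by (intro grid_bound_tendsto_0) (auto simp: of_nat_diff Suc_leI)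
  then have "(\<lambda>m. ennreal (b m)) \<longlonglongrightarrow> ennreal 0"
    by (rule tendsto_ennrealI)
  moreover have "eventually (\<lambda>m. hausdorff_premeasure \<alpha> s S \<le> ennreal (b m)) sequentially"
  proof -
    have "(\<lambda>m. c / real m) \<longlonglongrightarrow> 0" by (rule lim_const_over_n)
    then have "eventually (\<lambda>m. c / real m < \<alpha>) sequentially"
      using \<open>\<alpha> > 0\<close> by (rule order_tendstoD)
    then show ?thesis
      using eventually_gt_at_top[of 0]
    proof eventually_elim
      case (elim m)
      show ?case
        using lipschitz_graph_premeasure_le[OF R K lip, where m = m and \<alpha> = \<alpha> and s = s] elim
        by (simp add: b_def c_def)
    qed
  qed
  ultimately have "hausdorff_premeasure \<alpha> s S \<le> ennreal 0"
    by (rule tendsto_lowerbound) simp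
  then show "hausdorff_premeasure \<alpha> s S = 0" by simp
qed

section \<open>Zero sets of differentiable functions\<close>

text \<open>
  If \<open>f\<close> vanishes at \<open>x\<close> and \<open>y\<close>, the mean value theorem gives a point \<open>z\<close> between them at which the
  gradient is orthogonal to \<open>x - y\<close>. Solving for coordinate \<open>i\<close> of \<open>x - y\<close> is harmless as long as
  \<open>g i z\<close> stays away from \<open>0\<close> and the other partial derivatives stay bounded, which holds near \<open>a\<close>.
\<close>

lemma zero_set_locally_lipschitz_graph:
  fixes f :: "real ^ 'n::finite \<Rightarrow> real"
  assumes deriv: "\<And>x. (f has_derivative (\<lambda>h. \<Sum>j\<in>UNIV. g j x * h $ j)) (at x)"
    and cont: "\<And>j. continuous_on UNIV (g j)" and nz: "g i a \<noteq> 0"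
  obtains \<rho> K where "\<rho> > 0" "K \<ge> 0"
    "\<And>x y. x \<in> ball a \<rho> \<Longrightarrow> y \<in> ball a \<rho> \<Longrightarrow> f x = 0 \<Longrightarrow> f y = 0 \<Longrightarrow>
       \<bar>x $ i - y $ i\<bar> \<le> K * (\<Sum>j\<in>-{i}. \<bar>x $ j - y $ j\<bar>)"
proof -
  define c where "c = \<bar>g i a\<bar> / 2"
  define B where "B = (\<Sum>j\<in>UNIV. \<bar>g j a\<bar>) + 1"
  have "c > 0" using nz by (simp add: c_def)
  have "B > 0" by (simp add: B_def add_nonneg_pos sum_nonneg)
  have lim: "((\<lambda>x. g j x) \<longlongrightarrow> g j a) (nhds a)" for j
    using cont[of j] by (simp add: continuous_on_eq_continuous_at isCont_def tendsto_at_iff_tendsto_nhds)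
  have "eventually (\<lambda>x. c < \<bar>g i x\<bar>) (nhds a)"
    using tendsto_rabs[OF lim[of i]] by (rule order_tendstoD) (use nz in \<open>simp add: c_def\<close>)
  moreover have "eventually (\<lambda>x. \<forall>j. \<bar>g j x\<bar> < B) (nhds a)"
  proof (rule eventually_all_finite)
    fix j
    have "\<bar>g j a\<bar> \<le> (\<Sum>j\<in>UNIV. \<bar>g j a\<bar>)" by (rule member_le_sum) auto
    then have "\<bar>g j a\<bar> < B" by (simp add: B_def)
    then show "eventually (\<lambda>x. \<bar>g j x\<bar> < B) (nhds a)"
      using tendsto_rabs[OF lim[of j]] by (auto dest: order_tendstoD)
  qed
  ultimately have "eventually (\<lambda>x. c < \<bar>g i x\<bar> \<and> (\<forall>j. \<bar>g j x\<bar> < B)) (nhds a)"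
    by (rule eventually_conj)
  then obtain \<rho> where "\<rho> > 0" and near: "\<And>x. x \<in> ball a \<rho> \<Longrightarrow> c < \<bar>g i x\<bar> \<and> (\<forall>j. \<bar>g j x\<bar> < B)"
    by (auto simp: eventually_nhds_metric dist_commute)
  show ?thesis
  proof (rule that[of \<rho> "B / c"])
    fix x y assume x: "x \<in> ball a \<rho>" and y: "y \<in> ball a \<rho>" and zero: "f x = 0" "f y = 0"
    have "((\<lambda>t. f (y + t *\<^sub>R (x - y))) has_derivative
        (\<lambda>h. \<Sum>j\<in>UNIV. g j (y + t *\<^sub>R (x - y)) * (h *\<^sub>R (x - y)) $ j)) (at t within {0..1})" for t
      by (rule has_derivative_compose[OF _ deriv]) (auto intro!: derivative_eq_intros)
    then have "\<exists>t\<in>{0<..<1}. f (y + 1 *\<^sub>R (x - y)) - f (y + 0 *\<^sub>R (x - y))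
        = (\<Sum>j\<in>UNIV. g j (y + t *\<^sub>R (x - y)) * ((1 - 0) *\<^sub>R (x - y)) $ j)"
      by (intro mvt_simple) auto
    then obtain t where t: "0 < t" "t < 1"
      and eq: "(\<Sum>j\<in>UNIV. g j (y + t *\<^sub>R (x - y)) * (x - y) $ j) = 0"
      using zero by auto
    define z where "z = y + t *\<^sub>R (x - y)"
    have "z = (1 - t) *\<^sub>R y + t *\<^sub>R x" by (simp add: z_def algebra_simps)
    then have "z \<in> ball a \<rho>"
      using convexD[OF convex_ball y x, of "1 - t" t] t by simp
    note z = near[OF this]
    have "g i z * (x - y) $ i = - (\<Sum>j\<in>-{i}. g j z * (x - y) $ j)"
      using eq by (simp add: z_def[symmetric] sum.remove[of UNIV i] Compl_eq_Diff_UNIV)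
    then have "\<bar>g i z\<bar> * \<bar>(x - y) $ i\<bar> = \<bar>\<Sum>j\<in>-{i}. g j z * (x - y) $ j\<bar>"
      by (simp flip: abs_mult)
    also have "\<dots> \<le> (\<Sum>j\<in>-{i}. B * \<bar>(x - y) $ j\<bar>)"
      using z by (intro order_trans[OF sum_abs] sum_mono)
        (auto simp: abs_mult less_imp_le intro!: mult_right_mono)
    finally have "\<bar>g i z\<bar> * \<bar>(x - y) $ i\<bar> \<le> B * (\<Sum>j\<in>-{i}. \<bar>(x - y) $ j\<bar>)"
      by (simp add: sum_distrib_left)
    moreover have "c * \<bar>(x - y) $ i\<bar> \<le> \<bar>g i z\<bar> * \<bar>(x - y) $ i\<bar>"
      using z by (intro mult_right_mono) auto
    ultimately show "\<bar>x $ i - y $ i\<bar> \<le> B / c * (\<Sum>j\<in>-{i}. \<bar>x $ j - y $ j\<bar>)"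
      using \<open>c > 0\<close> by (simp add: field_simps)
  qed (use \<open>\<rho> > 0\<close> \<open>B > 0\<close> \<open>c > 0\<close> in auto)
qed

lemma hausdorff_null_nondegenerate_zeros:
  fixes f :: "real ^ 'n::finite \<Rightarrow> real"
  assumes s: "s > real CARD('n) - 1"
    and deriv: "\<And>x. (f has_derivative (\<lambda>h. \<Sum>j\<in>UNIV. g j x * h $ j)) (at x)"
    and cont: "\<And>j. continuous_on UNIV (g j)"
  shows "hausdorff_measure s {x. f x = 0 \<and> g i x \<noteq> 0} = 0"
proof -
  define F where "F = {U. open U \<and> hausdorff_measure s (U \<inter> {x. f x = 0}) = 0}"
  have F: "{x. f x = 0 \<and> g i x \<noteq> 0} \<subseteq> \<Union>F"
  proof clarify
    fix a assume "g i a \<noteq> 0"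
    with deriv cont obtain \<rho> K where "\<rho> > 0" "K \<ge> 0"
      "\<And>x y. x \<in> ball a \<rho> \<Longrightarrow> y \<in> ball a \<rho> \<Longrightarrow> f x = 0 \<Longrightarrow> f y = 0 \<Longrightarrow>
         \<bar>x $ i - y $ i\<bar> \<le> K * (\<Sum>j\<in>-{i}. \<bar>x $ j - y $ j\<bar>)"
      by (rule zero_set_locally_lipschitz_graph[of f g i a]) blast
    then have "hausdorff_measure s (ball a \<rho> \<inter> {x. f x = 0}) = 0"
      by (intro hausdorff_null_lipschitz_graph[OF s, of _ K i]) (auto intro: bounded_Int)
    then have "ball a \<rho> \<in> F" by (simp add: F_def)
    with \<open>\<rho> > 0\<close> show "a \<in> \<Union>F" by (meson UnionI centre_in_ball)
  qed
  have "open U" if "U \<in> F" for U using that by (simp add: F_def)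
  then obtain F' where F': "F' \<subseteq> F" "countable F'" "\<Union>F' = \<Union>F"
    by (rule Lindelof)
  have "{x. f x = 0 \<and> g i x \<noteq> 0} \<subseteq> \<Union>((\<lambda>U. U \<inter> {x. f x = 0}) ` F')"
  proof
    fix x assume x: "x \<in> {x. f x = 0 \<and> g i x \<noteq> 0}"
    then have "x \<in> \<Union>F'" unfolding F'(3) by (rule subsetD[OF F])
    then obtain U where "U \<in> F'" "x \<in> U" by (rule UnionE)
    moreover from x have "f x = 0" by simp
    ultimately show "x \<in> \<Union>((\<lambda>U. U \<inter> {x. f x = 0}) ` F')" by blast
  qed
  moreover have "hausdorff_measure s (\<Union>((\<lambda>U. U \<inter> {x. f x = 0}) ` F')) = 0"
  proof (rule hausdorff_null_Union)
    fix S assume "S \<in> (\<lambda>U. U \<inter> {x. f x = 0}) ` F'"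
    then obtain U where "U \<in> F'" and S: "S = U \<inter> {x. f x = 0}" by (rule imageE)
    then have "U \<in> F" using F'(1) by (intro subsetD[of F' F])
    then show "hausdorff_measure s S = 0" unfolding S by (simp add: F_def)
  qed (use F'(2) in simp)
  ultimately show ?thesis by (rule hausdorff_null_subset[rotated])
qed

section \<open>Polynomial functions of bounded degree\<close>

text \<open>
  The degree bound is part of the predicate, so that differentiation can be followed by rule
  induction. Multiplication by one variable at a time is enough to build every monomial.
\<close>

inductive poly_fun :: "nat \<Rightarrow> (real ^ 'n::finite \<Rightarrow> real) \<Rightarrow> bool" where
  const: "poly_fun d (\<lambda>x. c)"
| add: "poly_fun d f \<Longrightarrow> poly_fun d g \<Longrightarrow> poly_fun d (\<lambda>x. f x + g x)"
| var_mult: "poly_fun d f \<Longrightarrow> poly_fun (Suc d) (\<lambda>x. x $ i * f x)"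

lemma poly_fun_mono: "poly_fun d f \<Longrightarrow> d \<le> e \<Longrightarrow> poly_fun e f"
proof (induction arbitrary: e rule: poly_fun.induct)
  case (var_mult d f i)
  then show ?case by (cases e) (auto intro: poly_fun.var_mult)
qed (auto intro: poly_fun.intros)

lemma poly_fun_cmult: "poly_fun d f \<Longrightarrow> poly_fun d (\<lambda>x. c * f x)"
proof (induction rule: poly_fun.induct)
  case (add d f g)
  then show ?case using poly_fun.add by (simp add: distrib_left)
next
  case (var_mult d f i)
  then show ?case using poly_fun.var_mult[of d "\<lambda>x. c * f x" i] by (simp add: mult.left_commute)
qed (rule poly_fun.const)

lemma poly_fun_sum:
  "(\<And>i. i \<in> I \<Longrightarrow> poly_fun d (f i)) \<Longrightarrow> poly_fun d (\<lambda>x. \<Sum>i\<in>I. f i x)"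
  by (induction I rule: infinite_finite_induct) (auto intro: poly_fun.intros)

lemma poly_fun_diff: "poly_fun d f \<Longrightarrow> poly_fun d g \<Longrightarrow> poly_fun d (\<lambda>x. f x - g x)"
  using poly_fun.add[OF _ poly_fun_cmult[of d g "-1"]] by simp

lemma poly_fun_power_mult: "poly_fun d f \<Longrightarrow> poly_fun (k + d) (\<lambda>x. (x $ i) ^ k * f x)"
proof (induction k)
  case (Suc k)
  then show ?case using poly_fun.var_mult[of "k + d" "\<lambda>x. (x $ i) ^ k * f x" i]
    by (simp add: mult.assoc)
qed simp

lemma poly_fun_monomial:
  "poly_fun (\<Sum>i\<in>I. m i) (\<lambda>x. \<Prod>i\<in>I. (x $ i) ^ m i)"
  by (induction I rule: infinite_finite_induct) (auto intro: poly_fun.const poly_fun_power_mult)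

lemma poly_fun_0_constant: "poly_fun d f \<Longrightarrow> d = 0 \<Longrightarrow> \<exists>c. f = (\<lambda>x. c)"
  by (induction rule: poly_fun.induct) auto

text \<open>
  Truncated subtraction makes the degree bound correct for constants, whose derivatives are the
  zero constant.
\<close>

lemma poly_fun_partial_derivatives:
  assumes "poly_fun d f"
  obtains g where "\<And>x. (f has_derivative (\<lambda>h. \<Sum>j\<in>UNIV. g j x * h $ j)) (at x)"
    and "\<And>j. poly_fun (d - 1) (g j)"
proof -
  have "\<exists>g. (\<forall>x. (f has_derivative (\<lambda>h. \<Sum>j\<in>UNIV. g j x * h $ j)) (at x)) \<and>
      (\<forall>j. poly_fun (d - 1) (g j))"
    using assms
  proof (induction rule: poly_fun.induct)
    case (const d c)
    show ?case
      by (rule exI[of _ "\<lambda>_ _. 0"]) (auto intro: poly_fun.const)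
  next
    case (add d f1 f2)
    then obtain g1 g2 where
      d1: "\<And>x. (f1 has_derivative (\<lambda>h. \<Sum>j\<in>UNIV. g1 j x * h $ j)) (at x)" and p1: "\<And>j. poly_fun (d - 1) (g1 j)"
      and d2: "\<And>x. (f2 has_derivative (\<lambda>h. \<Sum>j\<in>UNIV. g2 j x * h $ j)) (at x)" and p2: "\<And>j. poly_fun (d - 1) (g2 j)"
      by blast
    have "((\<lambda>x. f1 x + f2 x) has_derivative (\<lambda>h. \<Sum>j\<in>UNIV. (g1 j x + g2 j x) * h $ j)) (at x)" for x
      using has_derivative_add[OF d1 d2] by (simp add: distrib_right sum.distrib)
    moreover have "poly_fun (d - 1) (\<lambda>x. g1 j x + g2 j x)" for j
      by (intro poly_fun.add p1 p2)
    ultimately show ?case by (intro exI[of _ "\<lambda>j x. g1 j x + g2 j x"]) blast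
  next
    case (var_mult d f i)
    then obtain g where
      deriv: "\<And>x. (f has_derivative (\<lambda>h. \<Sum>j\<in>UNIV. g j x * h $ j)) (at x)"
      and p: "\<And>j. poly_fun (d - 1) (g j)"
      by blast
    define g' where "g' j x = x $ i * g j x + (if j = i then 1 else 0) * f x" for j x
    have "((\<lambda>x. x $ i * f x) has_derivative (\<lambda>h. \<Sum>j\<in>UNIV. g' j x * h $ j)) (at x)" for x
    proof -
      have "((\<lambda>x. x $ i * f x) has_derivative (\<lambda>h. x $ i * (\<Sum>j\<in>UNIV. g j x * h $ j) + h $ i * f x)) (at x)"
        by (intro has_derivative_mult deriv bounded_linear_imp_has_derivative bounded_linear_vec_nth)
      also have "(\<lambda>h. x $ i * (\<Sum>j\<in>UNIV. g j x * h $ j) + h $ i * f x) = (\<lambda>h. \<Sum>j\<in>UNIV. g' j x * h $ j)"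
      proof
        fix h
        have "(\<Sum>j\<in>UNIV. (if j = i then 1 else 0) * f x * h $ j) = (\<Sum>j\<in>UNIV. if j = i then h $ i * f x else 0)"
          by (intro sum.cong) auto
        then show "x $ i * (\<Sum>j\<in>UNIV. g j x * h $ j) + h $ i * f x = (\<Sum>j\<in>UNIV. g' j x * h $ j)"
          by (simp add: g'_def distrib_right sum.distrib sum_distrib_left mult.assoc)
      qed
      finally show ?thesis .
    qed
    moreover have "poly_fun d (g' j)" for j
    proof -
      have "poly_fun d (\<lambda>x. x $ i * g j x)"
      \<comment> \<open>For constant \<open>f\<close> the degree bound leaves no room for the factor \<open>x $ i\<close>, so the partial
        derivatives have to be shown to be \<open>0\<close>.\<close>
      proof (cases d)
        case 0
        with var_mult.hyps obtain c where f: "f = (\<lambda>x. c)" using poly_fun_0_constant by blast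
        have "g j x = 0" for x
        proof -
          have "(f has_derivative (\<lambda>h. 0)) (at x)" unfolding f by (rule has_derivative_const)
          then have "(\<lambda>h. \<Sum>j\<in>UNIV. g j x * h $ j) = (\<lambda>h. 0)"
            by (rule has_derivative_unique[OF deriv])
          then have "(\<Sum>k\<in>UNIV. g k x * axis j 1 $ k) = 0" by meson
          then show "g j x = 0" by (simp add: axis_def if_distrib sum.If_cases)
        qed
        then show ?thesis by (simp add: poly_fun.const)
      next
        case (Suc d')
        then show ?thesis using poly_fun.var_mult[OF p[of j], of i] by simp
      qed
      then show ?thesis unfolding g'_def
        by (intro poly_fun.add poly_fun_cmult var_mult.hyps)
    qed
    ultimately show ?case by (intro exI[of _ g']) auto
  qed
  with that show ?thesis by blast
qed

lemma continuous_on_poly_fun: "poly_fun d f \<Longrightarrow> continuous_on A f"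
  by (induction rule: poly_fun.induct) (auto intro!: continuous_intros)

text \<open>
  Induction on the degree bound. If all partial derivatives vanish identically, \<open>f\<close> is a nonzero
  constant. Otherwise fix one that does not, \<open>g i\<close>, and split the zeros of \<open>f\<close> according to whether
  \<open>g i\<close> vanishes there.
\<close>

lemma hausdorff_null_poly_fun_zeros:
  fixes f :: "real ^ 'n::finite \<Rightarrow> real"
  assumes s: "s > real CARD('n) - 1" and "poly_fun d f" and "f a \<noteq> 0"
  shows "hausdorff_measure s {x. f x = 0} = 0"
  using assms(2,3)
proof (induction d arbitrary: f a)
  case 0
  then obtain c where "f = (\<lambda>x. c)" using poly_fun_0_constant by blast
  with 0 have "{x. f x = 0} = {}" by simp
  then show ?case by simp
next
  case (Suc d)
  obtain g where deriv: "\<And>x. (f has_derivative (\<lambda>h. \<Sum>j\<in>UNIV. g j x * h $ j)) (at x)"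
    and g: "\<And>j. poly_fun d (g j)"
    using poly_fun_partial_derivatives[OF Suc.prems(1)] by (metis diff_Suc_1)
  show ?case
  proof (cases "\<exists>i b. g i b \<noteq> 0")
    case True
    then obtain i b where "g i b \<noteq> 0" by blast
    have "hausdorff_measure s {x. f x = 0 \<and> g i x \<noteq> 0} = 0"
      using s deriv g by (intro hausdorff_null_nondegenerate_zeros continuous_on_poly_fun)
    moreover have "hausdorff_measure s {x. g i x = 0} = 0"
      using g \<open>g i b \<noteq> 0\<close> by (rule Suc.IH)
    ultimately have "hausdorff_measure s ({x. f x = 0 \<and> g i x \<noteq> 0} \<union> {x. g i x = 0}) = 0"
      by (rule hausdorff_null_Un)
    then show ?thesis by (rule hausdorff_null_subset) blast
  next
    case False
    then have "(f has_derivative (\<lambda>h. 0)) (at x)" for x using deriv[of x] by simp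
    then obtain c where "\<And>x. f x = c"
      using has_derivative_zero_constant[of UNIV f] by auto
    with Suc.prems have "{x. f x = 0} = {}" by auto
    then show ?thesis by simp
  qed
qed

section \<open>Interpolation at points of a determining set\<close>

lemma finite_bounded_exponents:
  "finite {m :: 'n::finite \<Rightarrow>\<^sub>0 nat. (\<Sum>i\<in>UNIV. Poly_Mapping.lookup m i) \<le> d}"
proof (rule finite_imageD)
  show "inj_on Poly_Mapping.lookup {m :: 'n \<Rightarrow>\<^sub>0 nat. (\<Sum>i\<in>UNIV. Poly_Mapping.lookup m i) \<le> d}"
    by (rule inj_onI) (simp add: lookup_inject)
  have "Poly_Mapping.lookup ` {m :: 'n \<Rightarrow>\<^sub>0 nat. (\<Sum>i\<in>UNIV. Poly_Mapping.lookup m i) \<le> d}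
      \<subseteq> PiE UNIV (\<lambda>_. {..d})"
  proof safe
    fix m :: "'n \<Rightarrow>\<^sub>0 nat" and i
    assume "(\<Sum>i\<in>UNIV. Poly_Mapping.lookup m i) \<le> d"
    moreover have "Poly_Mapping.lookup m i \<le> (\<Sum>i\<in>UNIV. Poly_Mapping.lookup m i)"
      by (rule member_le_sum) auto
    ultimately show "Poly_Mapping.lookup m i \<le> d" by simp
  qed simp
  then show "finite (Poly_Mapping.lookup ` {m :: 'n \<Rightarrow>\<^sub>0 nat. (\<Sum>i\<in>UNIV. Poly_Mapping.lookup m i) \<le> d})"
    by (rule finite_subset) (intro finite_PiE, auto)
qed

text \<open>
  A greedy construction in the style of Newton interpolation. Adding \<open>b k\<close> to the family, let \<open>h\<close>
  be the difference between \<open>b k\<close> and its interpolation at the points found so far. Either \<open>h\<close>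
  vanishes on \<open>Z\<close>, hence everywhere, and the old points suffice; or \<open>h\<close> is nonzero at some \<open>z\<close> in \<open>Z\<close>,
  and a multiple of it is the basis function of the new point \<open>z\<close>. The values of
  \<open>L\<close> at the points of \<open>T\<close> are an invariant of the induction: they make \<open>h\<close> vanish on \<open>T\<close>.
\<close>

lemma lagrange_basis_exists:
  fixes b :: "'i \<Rightarrow> real ^ 'n::finite \<Rightarrow> real"
  assumes "finite I" and "\<And>i. i \<in> I \<Longrightarrow> poly_fun d (b i)"
    and det: "\<And>f. poly_fun d f \<Longrightarrow> \<forall>z\<in>Z. f z = 0 \<Longrightarrow> f = (\<lambda>_. 0)"
  shows "\<exists>T L. finite T \<and> T \<subseteq> Z \<and> (\<forall>t\<in>T. poly_fun d (L t)) \<and>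
    (\<forall>t\<in>T. \<forall>u\<in>T. L t u = (if t = u then 1 else 0)) \<and>
    (\<forall>i\<in>I. \<forall>x. b i x = (\<Sum>t\<in>T. b i t * L t x))"
  using assms(1,2)
proof (induction I rule: finite_induct)
  case empty
  show ?case by (rule exI[of _ "{}"]) simp
next
  case (insert k I)
  have "poly_fun d (b i)" if "i \<in> I" for i
    using insert.prems that by blast
  from insert.IH[OF this] obtain T L where T: "finite T" "T \<subseteq> Z"
    and L: "\<forall>t\<in>T. poly_fun d (L t)"
    and delta: "\<forall>t\<in>T. \<forall>u\<in>T. L t u = (if t = u then 1 else 0)"
    and rep: "\<forall>i\<in>I. \<forall>x. b i x = (\<Sum>t\<in>T. b i t * L t x)"
    by blast
  define h where "h x = b k x - (\<Sum>t\<in>T. b k t * L t x)" for x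
  have h: "poly_fun d h"
    unfolding h_def using insert.prems L by (intro poly_fun_diff poly_fun_sum poly_fun_cmult) auto
  show ?case
  proof (cases "\<forall>z\<in>Z. h z = 0")
    case True
    with h have "h = (\<lambda>_. 0)" by (rule det)
    then have "h x = 0" for x by (rule fun_cong)
    then have "b k x = (\<Sum>t\<in>T. b k t * L t x)" for x
      unfolding h_def right_minus_eq .
    with rep have "\<forall>i\<in>insert k I. \<forall>x. b i x = (\<Sum>t\<in>T. b i t * L t x)" by blast
    with T L delta show ?thesis by blast
  next
    case False
    then obtain z where z: "z \<in> Z" "h z \<noteq> 0" by blast
    have h0: "h u = 0" if "u \<in> T" for u
    proof -
      have "(\<Sum>t\<in>T. b k t * L t u) = (\<Sum>t\<in>T. if t = u then b k t else 0)"
        using that by (intro sum.cong) (auto simp: delta)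
      then show ?thesis using that T by (simp add: h_def)
    qed
    then have "z \<notin> T" using z by blast
    define N where "N x = h x / h z" for x
    define L' where "L' t x = (if t = z then N x else L t x - L t z * N x)" for t x
    have N: "poly_fun d N"
      using poly_fun_cmult[OF h, of "1 / h z"] by (simp add: N_def[abs_def])
    have L': "poly_fun d (L' t)" if "t \<in> insert z T" for t
    proof (cases "t = z")
      case False
      with that show ?thesis
        unfolding L'_def by (auto intro!: poly_fun_diff poly_fun_cmult L[rule_format] N)
    qed (simp add: L'_def[abs_def] N)
    \<comment> \<open>The new interpolation is the old one plus a correction by the error at \<open>z\<close>.\<close>
    have expand: "(\<Sum>t\<in>insert z T. a t * L' t x)
        = (\<Sum>t\<in>T. a t * L t x) + (a z - (\<Sum>t\<in>T. a t * L t z)) * N x" for a x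
    proof -
      have "(\<Sum>t\<in>T. a t * L' t x) = (\<Sum>t\<in>T. a t * L t x - a t * L t z * N x)"
        using \<open>z \<notin> T\<close> by (intro sum.cong) (auto simp: L'_def algebra_simps)
      also have "\<dots> = (\<Sum>t\<in>T. a t * L t x) - (\<Sum>t\<in>T. a t * L t z) * N x"
        by (simp add: sum_subtractf sum_distrib_right)
      moreover have "L' z x = N x" by (simp add: L'_def)
      ultimately show ?thesis
        using T \<open>z \<notin> T\<close> by (simp add: left_diff_distrib)
    qed
    have rep': "b i x = (\<Sum>t\<in>insert z T. b i t * L' t x)" if "i \<in> insert k I" for i x
    proof (cases "i = k")
      case True
      have "b k x = (\<Sum>t\<in>T. b k t * L t x) + h z * N x"
        using z by (simp add: N_def h_def)
      then show ?thesis unfolding expand True h_def .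
    next
      case False
      with that have "i \<in> I" by simp
      then show ?thesis unfolding expand by (simp flip: rep[rule_format])
    qed
    have delta': "L' t u = (if t = u then 1 else 0)" if "t \<in> insert z T" "u \<in> insert z T" for t u
      using that z \<open>z \<notin> T\<close> by (auto simp: L'_def N_def h0 delta)
    show ?thesis
      by (intro exI[of _ "insert z T"] exI[of _ L'] conjI ballI allI L' delta' rep') (use T z in auto)
  qed
qed

lemma mpoly_eval_eq_sum_monomials:
  assumes "mpoly_degree P \<le> d"
  shows "mpoly_eval P x = (\<Sum>m | (\<Sum>i\<in>UNIV. Poly_Mapping.lookup m i) \<le> d.
    Poly_Mapping.lookup P m * (\<Prod>i\<in>UNIV. (x $ i) ^ Poly_Mapping.lookup m i))"
  unfolding mpoly_eval_def
  using assms by (intro sum.mono_neutral_left finite_bounded_exponents)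
    (auto simp: mpoly_degree_le_iff in_keys_iff)

lemma unit_cube_eq_cbox: "unit_cube = cbox 0 1"
  by (auto simp: unit_cube_def mem_box_cart)

lemma compact_unit_cube: "compact unit_cube"
  unfolding unit_cube_eq_cbox by (rule compact_cbox)

text \<open>
  The interpolation formula bounds \<open>P\<close> at \<open>x\<close> by the Lebesgue function \<open>\<Sum>t\<in>T. \<bar>L t x\<bar>\<close> of the
  nodes, a continuous function on the compact cube.
\<close>

lemma definite_if_determining:
  fixes Z :: "(real ^ 'n::finite) set"
  assumes "Z \<subseteq> unit_cube"
    and det: "\<And>f. poly_fun d f \<Longrightarrow> \<forall>z\<in>Z. f z = 0 \<Longrightarrow> f = (\<lambda>_. 0)"
  shows "definite d Z"
proof -
  define M where "M = {m :: 'n \<Rightarrow>\<^sub>0 nat. (\<Sum>i\<in>UNIV. Poly_Mapping.lookup m i) \<le> d}"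
  define mono where "mono m x = (\<Prod>i\<in>UNIV. (x $ i) ^ Poly_Mapping.lookup m i)"
    for m :: "'n \<Rightarrow>\<^sub>0 nat" and x :: "real ^ 'n"
  have "poly_fun d (mono m)" if "m \<in> M" for m
    using that unfolding mono_def M_def by (auto intro: poly_fun_mono[OF poly_fun_monomial])
  moreover have "finite M" unfolding M_def by (rule finite_bounded_exponents)
  ultimately obtain T L
    where T: "finite T" "T \<subseteq> Z" and L: "\<forall>t\<in>T. poly_fun d (L t)"
      and rep: "\<forall>m\<in>M. \<forall>x. mono m x = (\<Sum>t\<in>T. mono m t * L t x)"
    using lagrange_basis_exists[of M d mono Z] det by blast
  have interpolate: "mpoly_eval P x = (\<Sum>t\<in>T. mpoly_eval P t * L t x)" if "mpoly_degree P \<le> d" for P x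
  proof -
    have eval: "mpoly_eval P y = (\<Sum>m\<in>M. Poly_Mapping.lookup P m * mono m y)" for y
      using mpoly_eval_eq_sum_monomials[OF that] by (simp add: M_def mono_def)
    have "mpoly_eval P x = (\<Sum>m\<in>M. \<Sum>t\<in>T. Poly_Mapping.lookup P m * mono m t * L t x)"
      unfolding eval by (intro sum.cong refl) (simp add: rep[rule_format, of _ x] sum_distrib_left mult.assoc)
    also have "\<dots> = (\<Sum>t\<in>T. mpoly_eval P t * L t x)"
      unfolding eval by (subst sum.swap) (simp add: sum_distrib_right)
    finally show ?thesis .
  qed
  have "continuous_on unit_cube (\<lambda>x. \<Sum>t\<in>T. \<bar>L t x\<bar>)"
    by (intro continuous_intros continuous_on_poly_fun[OF L[rule_format]])
  then have "bounded ((\<lambda>x. \<Sum>t\<in>T. \<bar>L t x\<bar>) ` unit_cube)"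
    by (intro compact_imp_bounded compact_continuous_image compact_unit_cube)
  then obtain C where C: "\<And>x. x \<in> unit_cube \<Longrightarrow> (\<Sum>t\<in>T. \<bar>L t x\<bar>) \<le> C"
    unfolding bounded_iff by fastforce
  have "\<bar>mpoly_eval P x\<bar> \<le> C"
    if P: "mpoly_degree P \<le> d" "\<forall>z\<in>Z. \<bar>mpoly_eval P z\<bar> \<le> 1" and x: "x \<in> unit_cube" for P x
  proof -
    have "\<bar>mpoly_eval P x\<bar> \<le> (\<Sum>t\<in>T. \<bar>mpoly_eval P t\<bar> * \<bar>L t x\<bar>)"
      unfolding interpolate[OF P(1), of x] by (rule order_trans[OF sum_abs]) (simp add: abs_mult)
    also have "\<dots> \<le> (\<Sum>t\<in>T. 1 * \<bar>L t x\<bar>)"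
      using P(2) T by (intro sum_mono mult_right_mono) auto
    also have "\<dots> \<le> C" using C[OF x] by simp
    finally show ?thesis .
  qed
  with assms(1) show ?thesis unfolding definite_def by blast
qed

theorem theorem2p2:
  fixes Z :: "(real ^ 'n::finite) set" and s :: real and d :: nat
  assumes "s > real CARD('n) - 1"
    and "Z \<subseteq> unit_cube"
    and "hausdorff_measure s Z > 0"
    and "d \<ge> 1"
  shows "definite d Z"
proof (rule definite_if_determining[OF assms(2)])
  fix f :: "real ^ 'n \<Rightarrow> real"
  assume f: "poly_fun d f" "\<forall>z\<in>Z. f z = 0"
  show "f = (\<lambda>_. 0)"
  proof (rule ccontr)
    assume "f \<noteq> (\<lambda>_. 0)"
    then obtain a where "f a \<noteq> 0" by blast
    with assms(1) f(1) have "hausdorff_measure s {x. f x = 0} = 0"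
      by (rule hausdorff_null_poly_fun_zeros)
    then have "hausdorff_measure s Z = 0"
      by (rule hausdorff_null_subset) (use f(2) in blast)
    with assms(3) show False by simp
  qed
qed

end
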